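(* There exists a global constant $\mathbf K>0$ such that for all $M\in\mathbb N$ and $\mathcal A\subset\{0,\dots,M-1\}$ with $1<|\mathcal A|<M$ for which $\delta=\log|\mathcal A|/\log M$ satisfies $$\Big|\delta-\frac12\Big|\le\frac1{\mathbf K\log M},$$ the fractal uncertainty exponent $\beta=\beta(M,\mathcal A)$ satisfies $$\beta\ \ge\ \max\Big(0,\frac12-\delta\Big)+\frac1{\mathbf K\log M}.$$
   Context: $\mathbb Z_N=\mathbb Z/N\mathbb Z\simeq\{0,\dots,N-1\}$; $\ell^2_N$ is the space of functions $u:\mathbb Z_N\to\mathbb C$ with $\|u\|_{\ell^2_N}^2=\sum_j|u(j)|^2$; $\mathcal F_Nu(j)=\frac1{\sqrt N}\sum_{\ell=0}^{N-1}\exp(-2\pi ij\ell/N)u(\ell)$; $\mathbf 1_X$ is multiplication by the indicator function of $X\subset\mathbb Z_N$. For $N=M^k$: $\mathcal C_k=\{\sum_{j=0}^{k-1}a_jM^j\mid a_0,\dots,a_{k-1}\in\mathcal A\}\subset\mathbb Z_N$ and $r_k=\|\mathbf 1_{\mathcal C_k}\mathcal F_N\mathbf 1_{\mathcal C_k}\|_{\ell^2_N\to\ell^2_N}$. The fractal uncertainty exponent is $\beta(M,\mathcal A)=-\lim_{k\to\infty}\frac{\log r_k}{k\log M}$ (the limit exists). *)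

theory Defs
  imports "HOL-Analysis.Analysis"
begin

text \<open>
  Since the dimension \<open>N = M ^ k\<close> varies inside the statement, the cyclic group of order \<open>N\<close> is
  represented by \<open>{..<N}\<close>, and a function on it by a function on \<open>nat\<close> that vanishes outside
  \<open>{..<N}\<close>.
\<close>

definition ell2 :: "nat \<Rightarrow> (nat \<Rightarrow> complex) set" where
  "ell2 N = {u. \<forall>j. j \<notin> {..<N} \<longrightarrow> u j = 0}"

definition ell2_norm :: "nat \<Rightarrow> (nat \<Rightarrow> complex) \<Rightarrow> real" where
  "ell2_norm N u = L2_set (\<lambda>j. cmod (u j)) {..<N}"

definition ell2_opnorm :: "nat \<Rightarrow> ((nat \<Rightarrow> complex) \<Rightarrow> (nat \<Rightarrow> complex)) \<Rightarrow> real" where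
  "ell2_opnorm N T = (SUP u\<in>{u \<in> ell2 N. ell2_norm N u \<le> 1}. ell2_norm N (T u))"

definition dft :: "nat \<Rightarrow> (nat \<Rightarrow> complex) \<Rightarrow> (nat \<Rightarrow> complex)" where
  "dft N u = (\<lambda>j. if j < N
     then (1 / complex_of_real (sqrt (real N))) *
          (\<Sum>l<N. exp (- 2 * complex_of_real pi * \<i> * of_nat j * of_nat l / of_nat N) * u l)
     else 0)"

definition ind_mult :: "nat set \<Rightarrow> (nat \<Rightarrow> complex) \<Rightarrow> (nat \<Rightarrow> complex)" where
  "ind_mult X u = (\<lambda>j. indicator X j * u j)"

text \<open>For \<open>A \<subseteq> {..<M}\<close> the sums below lie in \<open>{..<M ^ k}\<close>, so no reduction modulo \<open>M ^ k\<close> is needed.\<close>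

definition cantor_set :: "nat \<Rightarrow> nat set \<Rightarrow> nat \<Rightarrow> nat set" where
  "cantor_set M A k = {(\<Sum>j<k. a j * M ^ j) | a. \<forall>j<k. a j \<in> A}"

definition fup_norm :: "nat \<Rightarrow> nat set \<Rightarrow> nat \<Rightarrow> real" where
  "fup_norm M A k =
     ell2_opnorm (M ^ k)
       (ind_mult (cantor_set M A k) \<circ> dft (M ^ k) \<circ> ind_mult (cantor_set M A k))"

text \<open>
  The constant \<open>lim\<close> is only meaningful for convergent sequences; the limit here exists for
  \<open>A \<subseteq> {..<M}\<close> with \<open>1 < card A < M\<close>, by submultiplicativity of \<open>fup_norm M A\<close> and
  the lower bound \<open>fup_norm M A k \<ge> 1 / sqrt (M ^ k)\<close>.
\<close>

definition fup_exponent :: "nat \<Rightarrow> nat set \<Rightarrow> real" where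
  "fup_exponent M A = - lim (\<lambda>k. ln (fup_norm M A k) / (real k * ln (real M)))"

definition cantor_dim :: "nat \<Rightarrow> nat set \<Rightarrow> real" where
  "cantor_dim M A = ln (real (card A)) / ln (real M)"

end

theory Submission
  imports Defs
begin

text \<open>
  Write \<open>n = card A\<close>, \<open>N = M ^ k\<close>, \<open>C\<^sub>k = cantor_set M A k\<close> and \<open>r\<^sub>k = fup_norm M A k\<close>.

  \<^emph>\<open>Reduction to additive energy.\<close> Let \<open>E\<^sub>k\<close> be the number of \<open>(a, b, c, d)\<close> in \<open>C\<^sub>k\<close> with
  \<open>a - b + c - d = 0\<close> modulo \<open>N\<close>. Estimating the operator norm of \<open>T\<^sup>*T\<close>, for the restricted Fourier
  transform \<open>T\<close>, by its Hilbert--Schmidt norm gives \<open>r\<^sub>k ^ 4 \<le> N powr (- 3 / 2) * E\<^sub>k\<close>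
  (\<open>opnorm_restricted_dft_le_energy\<close>). The trivial bound \<open>E\<^sub>k \<le> n ^ (3 * k)\<close> therefore yields the
  exponent \<open>3/8 - 3/4 * \<delta>\<close>, which vanishes at \<open>\<delta> = 1/2\<close>. A saving
  \<open>E\<^sub>k \<le> 2 * (\<mu> * n ^ 3) ^ k\<close> with an absolute constant \<open>\<mu> < 1\<close> adds \<open>- ln \<mu> / (4 * ln M)\<close> to it.
  For \<open>\<bar>\<delta> - 1/2\<bar> \<le> 1 / (K * ln M)\<close> and \<open>K\<close> large this addition dominates everything else.

  \<^emph>\<open>The saving.\<close> One digit need not save anything: if \<open>A\<close> is a coset of a subgroup of the integers
  modulo \<open>M\<close>, its energy modulo \<open>M\<close> is \<open>n ^ 3\<close>, and even \<open>r\<^sub>1 = 1\<close> can occur. The saving comes from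
  the carries. A relation in \<open>C\<^bsub>k+1\<^esub>\<close> with incoming carry \<open>s\<close> is a relation \<open>a - b + c - d + s = M * t\<close>
  between the lowest digits together with a relation in \<open>C\<^sub>k\<close> with carry \<open>t\<close>, where
  \<open>t \<in> {-1, 0, 1}\<close>. The step from \<open>s = 0\<close> to \<open>t = 0\<close> is a relation between integers, and at most
  \<open>15/16 * n ^ 3\<close> quadruples satisfy it (\<open>energy_int_gap\<close>). A step from \<open>s = 1\<close> or \<open>s = - 1\<close> is
  a relation modulo \<open>M\<close> shifted by one, and again at most \<open>15/16 * n ^ 3\<close> quadruples satisfy it
  (\<open>energy_mod_gap\<close>). So at most every other digit comes without a saving, and a weight slightly
  below one on the states \<open>s = 1\<close> and \<open>s = - 1\<close> turns this into a uniform factor per digit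
  (\<open>energy_cantor_le\<close>).

  Both gaps have the same reason. If nearly all triples of \<open>A\<close> can be completed to a solution of
  \<open>a - b + c - d + s = 0\<close>, then the \<open>u\<close> for which \<open>A + u\<close> almost equals \<open>A\<close> form a group containing
  \<open>s\<close>. In the integers this group also contains a nonzero difference of elements of \<open>A\<close>, so it is
  infinite, which is absurd for a finite set \<open>A\<close>. Modulo \<open>M\<close> with \<open>s = 1\<close> it is everything, which forces \<open>A\<close> to fill three quarters of the residues, whereas here
  \<open>n\<close> is about \<open>sqrt M\<close>.

  The limit defining the exponent exists because \<open>r\<^sub>k\<close> is submultiplicative
  (\<open>fup_norm_add_le\<close>), by splitting the Fourier transform of order \<open>M ^ (k + l)\<close> into transforms of
  orders \<open>M ^ k\<close> and \<open>M ^ l\<close>.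
\<close>

section \<open>Almost periods of sets with large additive energy\<close>

text \<open>
  The modulus \<open>m = 0\<close> is the case of the integers, since \<open>0 dvd x\<close> means \<open>x = 0\<close>; this lets the
  integers and the residues modulo \<open>M\<close> share all arguments below. Counts are written as sums of
  indicators, so that double counting is an exchange of sums.
\<close>

definition hit :: "int \<Rightarrow> int \<Rightarrow> nat \<Rightarrow> nat \<Rightarrow> real" where
  "hit m u c d = of_bool (m dvd int c - int d + u)"

definition matches :: "int \<Rightarrow> nat set \<Rightarrow> int \<Rightarrow> real" where
  "matches m A u = (\<Sum>c\<in>A. \<Sum>d\<in>A. hit m u c d)"

definition defect :: "int \<Rightarrow> nat set \<Rightarrow> int \<Rightarrow> real" where
  "defect m A u = real (card A) - matches m A u"

text \<open>
  The number of quadruples in \<open>A\<close> with \<open>a - b + c - d + s = 0\<close> modulo \<open>m\<close>; for \<open>s = 0\<close> this is the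
  usual additive energy.
\<close>

definition energy :: "int \<Rightarrow> nat set \<Rightarrow> int \<Rightarrow> real" where
  "energy m A s = (\<Sum>a\<in>A. \<Sum>b\<in>A. matches m A (int a - int b + s))"

definition separated :: "int \<Rightarrow> nat set \<Rightarrow> bool" where
  "separated m A \<longleftrightarrow> finite A \<and> (\<forall>x\<in>A. \<forall>y\<in>A. m dvd int x - int y \<longrightarrow> x = y)"

lemma separated_lessThan:
  assumes "A \<subseteq> {..<M}"
  shows "separated (int M) A"
  unfolding separated_def
proof (intro conjI ballI impI)
  show "finite A" using assms finite_subset by blast
  fix x y assume "x \<in> A" "y \<in> A" "int M dvd int x - int y"
  then have "int x mod int M = int y mod int M" "x < M" "y < M"
    using assms by (auto simp: mod_eq_dvd_iff)
  then show "x = y" by simp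
qed

lemma hit_nonneg [simp]: "0 \<le> hit m u c d"
  by (simp add: hit_def)

lemma hit_cong:
  assumes "m dvd u - v"
  shows "hit m u = hit m v"
proof (intro ext)
  fix c d
  have "m dvd int c - int d + u \<longleftrightarrow> m dvd int c - int d + v"
    using dvd_add_left_iff[OF assms, of "int c - int d + v"] by (simp add: algebra_simps)
  then show "hit m u c d = hit m v c d" by (simp add: hit_def)
qed

lemma hit_flip: "hit m (- u) c d = hit m u d c"
proof -
  have "int c - int d + - u = - (int d - int c + u)" by simp
  then show ?thesis by (simp only: hit_def dvd_minus_iff)
qed

lemma sum_of_bool_le_1:
  assumes "finite A" "\<And>x y. x \<in> A \<Longrightarrow> y \<in> A \<Longrightarrow> P x \<Longrightarrow> P y \<Longrightarrow> x = y"
  shows "(\<Sum>x\<in>A. of_bool (P x) :: real) \<le> 1"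
proof -
  have "card {x \<in> A. P x} \<le> Suc 0"
    using assms by (subst card_le_Suc0_iff_eq) auto
  then show ?thesis using assms(1) by (simp add: sum.If_cases of_bool_def Int_def)
qed

lemma hit_row_le_1:
  assumes "separated m A"
  shows "(\<Sum>d\<in>A. hit m u c d) \<le> 1"
  unfolding hit_def
proof (rule sum_of_bool_le_1)
  fix x y assume xy: "x \<in> A" "y \<in> A" "m dvd int c - int x + u" "m dvd int c - int y + u"
  from dvd_diff[OF xy(4,3)] have "m dvd int x - int y" by (simp add: algebra_simps)
  with assms xy show "x = y" unfolding separated_def by blast
qed (use assms separated_def in auto)

lemma hit_column_le_1:
  assumes "separated m A"
  shows "(\<Sum>c\<in>A. hit m u c d) \<le> 1"
  using hit_row_le_1[OF assms, of "- u" d] by (simp add: hit_flip)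

lemma matches_le_card:
  assumes "separated m A"
  shows "matches m A u \<le> card A"
  unfolding matches_def using sum_mono[of A, OF hit_row_le_1[OF assms]] by simp

lemma defect_nonneg: "separated m A \<Longrightarrow> 0 \<le> defect m A u"
  using matches_le_card[of m A u] by (simp add: defect_def)

lemma matches_cong: "m dvd u - v \<Longrightarrow> matches m A u = matches m A v"
  by (simp add: matches_def hit_cong)

lemma defect_cong: "m dvd u - v \<Longrightarrow> defect m A u = defect m A v"
  by (simp add: defect_def matches_cong)

lemma defect_uminus: "defect m A (- u) = defect m A u"
proof -
  have "matches m A (- u) = matches m A u"
    unfolding matches_def hit_flip by (rule sum.swap)
  then show ?thesis by (simp add: defect_def)
qed

text \<open>
  The elements that \<open>u\<close> carries out of \<open>A\<close>, and those that \<open>v\<close> then carries out, are the only ones that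
  \<open>u + v\<close> can carry out of \<open>A\<close>. In terms of sums: \<open>d\<close> is the midpoint of a path \<open>c, d, e\<close> whenever
  it lies in the range of the shift by \<open>u\<close> and in the domain of the shift by \<open>v\<close>.
\<close>

lemma defect_add_le:
  assumes A: "separated m A"
  shows "defect m A (u + v) \<le> defect m A u + defect m A v"
proof -
  define col where "col d = (\<Sum>c\<in>A. hit m u c d)" for d
  define row where "row d = (\<Sum>e\<in>A. hit m v d e)" for d
  have le1: "col d \<le> 1" "row d \<le> 1" for d
    using hit_row_le_1[OF A] hit_column_le_1[OF A] by (auto simp: col_def row_def)
  have step: "(\<Sum>d\<in>A. hit m u c d * hit m v d e) \<le> hit m (u + v) c e" for c e
  proof -
    have "hit m u c d * hit m v d e \<le> hit m (u + v) c e * hit m u c d" for d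
    proof (cases "m dvd int c - int d + u \<and> m dvd int d - int e + v")
      case True
      then have "m dvd (int c - int d + u) + (int d - int e + v)"
        using dvd_add by blast
      then have "m dvd int c - int e + (u + v)" by (simp add: algebra_simps)
      then show ?thesis using True by (simp add: hit_def)
    next
      case False
      then show ?thesis by (auto simp: hit_def)
    qed
    then have "(\<Sum>d\<in>A. hit m u c d * hit m v d e) \<le> hit m (u + v) c e * (\<Sum>d\<in>A. hit m u c d)"
      by (auto simp: sum_distrib_left intro: sum_mono)
    also have "\<dots> \<le> hit m (u + v) c e * 1"
      by (intro mult_left_mono hit_row_le_1 A hit_nonneg)
    finally show ?thesis by simp
  qed
  have "matches m A u + matches m A v - card A = (\<Sum>d\<in>A. col d + row d - 1)"
    unfolding matches_def col_def row_def
    by (subst sum.swap[of "\<lambda>c d. hit m u c d"]) (simp add: sum.distrib sum_subtractf)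
  also have "\<dots> \<le> (\<Sum>d\<in>A. col d * row d)"
  proof (rule sum_mono)
    fix d
    have "0 \<le> (1 - col d) * (1 - row d)" using le1 by simp
    then show "col d + row d - 1 \<le> col d * row d" by (simp add: algebra_simps)
  qed
  also have "\<dots> = (\<Sum>d\<in>A. \<Sum>c\<in>A. \<Sum>e\<in>A. hit m u c d * hit m v d e)"
    by (simp add: col_def row_def sum_product)
  also have "\<dots> = (\<Sum>c\<in>A. \<Sum>d\<in>A. \<Sum>e\<in>A. hit m u c d * hit m v d e)"
    by (rule sum.swap)
  also have "\<dots> = (\<Sum>c\<in>A. \<Sum>e\<in>A. \<Sum>d\<in>A. hit m u c d * hit m v d e)"
    by (intro sum.cong refl sum.swap)
  also have "\<dots> \<le> matches m A (u + v)"
    unfolding matches_def by (intro sum_mono step)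
  finally show ?thesis by (simp add: defect_def)
qed

lemma energy_le_card_cubed:
  assumes "separated m A"
  shows "energy m A s \<le> real (card A) ^ 3"
proof -
  have "energy m A s \<le> (\<Sum>a\<in>A. \<Sum>b\<in>A. real (card A))"
    unfolding energy_def by (intro sum_mono matches_le_card assms)
  then show ?thesis by (simp add: power3_eq_cube)
qed

lemma sum_defect_eq:
  "(\<Sum>a\<in>A. \<Sum>b\<in>A. defect m A (int a - int b + s)) = real (card A) ^ 3 - energy m A s"
  by (simp add: defect_def energy_def sum_subtractf power3_eq_cube)

text \<open>
  By the triangle inequality along \<open>s = (a - b + s) + (b - c + s) - (a - c + s)\<close>, the defect of \<open>s\<close>
  is at most three times the average defect of \<open>a - b + s\<close>, and the energy is exactly what controls
  this average.
\<close>

lemma defect_shift_small: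
  assumes A: "separated m A" "A \<noteq> {}"
    and E: "15 / 16 * real (card A) ^ 3 \<le> energy m A s"
  shows "defect m A s \<le> 3 / 16 * card A"
proof -
  let ?n = "real (card A)" and ?h = "defect m A"
  let ?S = "\<Sum>a\<in>A. \<Sum>b\<in>A. ?h (int a - int b + s)"
  have n: "?n > 0" using A by (simp add: separated_def card_gt_0_iff)
  have tri: "?h s \<le> ?h (int a - int b + s) + ?h (int b - int c + s) + ?h (int a - int c + s)"
    for a b c
  proof -
    have "?h ((int a - int b + s) + (int b - int c + s) + - (int a - int c + s))
        \<le> ?h (int a - int b + s) + ?h (int b - int c + s) + ?h (- (int a - int c + s))"
      by (intro order_trans[OF defect_add_le] add_mono A order_refl)
    then show ?thesis unfolding defect_uminus by (simp add: algebra_simps)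
  qed
  have "?n ^ 3 * ?h s = (\<Sum>a\<in>A. \<Sum>b\<in>A. \<Sum>c\<in>A. ?h s)"
    by (simp add: power3_eq_cube)
  also have "\<dots> \<le> (\<Sum>a\<in>A. \<Sum>b\<in>A. \<Sum>c\<in>A.
      ?h (int a - int b + s) + ?h (int b - int c + s) + ?h (int a - int c + s))"
    by (intro sum_mono tri)
  also have "\<dots> = ?n * ?S + ?n * ?S + ?n * ?S"
    unfolding sum.distrib by (intro arg_cong2[of _ _ _ _ "(+)"]) (simp_all add: sum_distrib_left)
  also have "\<dots> = 3 * (?n * ?S)" by simp
  also have "?S \<le> ?n ^ 3 / 16"
    using E by (simp add: sum_defect_eq)
  finally have "?n ^ 3 * ?h s \<le> ?n ^ 3 * (3 / 16 * ?n)"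
    using n by (simp add: mult_left_mono algebra_simps)
  then show ?thesis using n by (simp add: mult_le_cancel_left_pos)
qed

text \<open>
  A defect that is not too large is small. If \<open>u = d - c\<close> modulo \<open>m\<close> with \<open>c, d \<in> A\<close>, then
  \<open>u = (d - b + s) - (c - b + s)\<close> for all \<open>b\<close>, so the defect \<open>h\<close> of \<open>u\<close> is bounded by the sum of
  two defects, averaged over \<open>b\<close>. There are \<open>n - h\<close> such pairs \<open>(c, d)\<close>, and each element of \<open>A\<close> occurs at
  most once on either side; summation over all pairs gives \<open>(n - h) * h \<le> n\<^sup>2 / 8\<close>. This is the gap that
  makes the almost periods closed under addition.
\<close>

lemma defect_dichotomy:
  assumes A: "separated m A" "A \<noteq> {}"
    and E: "15 / 16 * real (card A) ^ 3 \<le> energy m A s"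
    and u: "defect m A u \<le> card A / 2"
  shows "defect m A u \<le> card A / 4"
proof -
  let ?n = "real (card A)" and ?h = "defect m A"
  let ?S = "\<Sum>a\<in>A. \<Sum>b\<in>A. ?h (int a - int b + s)"
  define H where "H a = (\<Sum>b\<in>A. ?h (int a - int b + s))" for a
  have n: "?n > 0" using A by (simp add: separated_def card_gt_0_iff)
  have H0: "0 \<le> H a" for a unfolding H_def by (intro sum_nonneg defect_nonneg A)
  have key: "hit m u c d * (?n * ?h u) \<le> hit m u c d * (H c + H d)" for c d
  proof (cases "m dvd int c - int d + u")
    case True
    have "?h u \<le> ?h (int d - int b + s) + ?h (int c - int b + s)" for b
    proof -
      have "m dvd u - ((int d - int b + s) + - (int c - int b + s))"
        using True by (simp add: algebra_simps)
      then have "?h u = ?h ((int d - int b + s) + - (int c - int b + s))"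
        by (rule defect_cong)
      also have "\<dots> \<le> ?h (int d - int b + s) + ?h (int c - int b + s)"
        using defect_add_le[OF A(1)] by (metis defect_uminus)
      finally show ?thesis .
    qed
    then have "(\<Sum>b\<in>A. ?h u) \<le> (\<Sum>b\<in>A. ?h (int d - int b + s) + ?h (int c - int b + s))"
      by (intro sum_mono)
    also have "\<dots> = H c + H d" by (simp add: H_def sum.distrib)
    finally show ?thesis by (intro mult_left_mono) auto
  qed (simp add: hit_def)
  have "(?n - ?h u) * (?n * ?h u) = (\<Sum>c\<in>A. \<Sum>d\<in>A. hit m u c d * (?n * ?h u))"
    by (simp add: defect_def matches_def sum_distrib_right)
  also have "\<dots> \<le> (\<Sum>c\<in>A. \<Sum>d\<in>A. hit m u c d * (H c + H d))"
    by (intro sum_mono key)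
  also have "\<dots> = (\<Sum>c\<in>A. (\<Sum>d\<in>A. hit m u c d) * H c) + (\<Sum>d\<in>A. (\<Sum>c\<in>A. hit m u c d) * H d)"
    by (simp add: distrib_left sum.distrib sum_distrib_right sum.swap[of "\<lambda>c d. hit m u c d * H d"])
  also have "\<dots> \<le> (\<Sum>c\<in>A. 1 * H c) + (\<Sum>d\<in>A. 1 * H d)"
    by (intro add_mono sum_mono mult_right_mono hit_row_le_1 hit_column_le_1 A H0)
  also have "\<dots> = 2 * ?S" by (simp add: H_def)
  also have "?S \<le> ?n ^ 3 / 16"
    using E by (simp add: sum_defect_eq)
  finally have "?n * ((?n - ?h u) * ?h u) \<le> ?n * (?n ^ 2 / 8)"
    by (simp add: power3_eq_cube power2_eq_square algebra_simps)
  then have *: "(?n - ?h u) * ?h u \<le> ?n ^ 2 / 8"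
    using n by (simp add: mult_le_cancel_left_pos)
  have "?n / 2 * ?h u \<le> (?n - ?h u) * ?h u"
    using u by (intro mult_right_mono defect_nonneg A) auto
  with * have "?n * ?h u \<le> ?n * (?n / 4)" by (simp add: power2_eq_square)
  then show ?thesis using n by (simp add: mult_le_cancel_left_pos)
qed

lemma defect_multiples_small:
  assumes A: "separated m A" "A \<noteq> {}"
    and E: "15 / 16 * real (card A) ^ 3 \<le> energy m A s"
    and u: "defect m A u \<le> card A / 4"
  shows "defect m A (int k * u) \<le> card A / 4"
proof (induction k)
  case 0
  have "defect m A (int 0 * u) = defect m A (u + - u)" by simp
  also have "\<dots> \<le> defect m A u + defect m A u"
    using defect_add_le[OF A(1)] by (metis defect_uminus)
  finally show ?case using u by (intro defect_dichotomy[OF A E]) simp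
next
  case (Suc k)
  have "defect m A (int (Suc k) * u) \<le> defect m A (int k * u) + defect m A u"
    using defect_add_le[OF A(1), of "int k * u" u] by (simp add: algebra_simps)
  then show ?case using Suc u by (intro defect_dichotomy[OF A E]) simp
qed

text \<open>
  Otherwise some difference \<open>a - b \<noteq> 0\<close> is an almost period of \<open>A\<close>, because the pairs with \<open>a = b\<close>
  are at most half of all pairs. Then all its multiples are almost periods, and in particular
  differences of elements of the finite set \<open>A\<close>.
\<close>

lemma energy_int_gap:
  fixes A :: "nat set"
  assumes "finite A" "2 \<le> card A"
  shows "energy 0 A 0 \<le> 15 / 16 * real (card A) ^ 3"
proof (rule ccontr)
  let ?n = "real (card A)" and ?h = "defect 0 A"
  assume "\<not> ?thesis"
  then have E: "15 / 16 * ?n ^ 3 < energy 0 A 0" by simp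
  have A: "separated 0 A" "A \<noteq> {}" using assms by (auto simp: separated_def)
  obtain a b where ab: "a \<in> A" "b \<in> A" "a \<noteq> b" "?h (int a - int b) \<le> ?n / 4"
  proof (rule ccontr)
    assume "\<not> thesis"
    then have big: "?n / 4 < ?h (int a - int b)" if "a \<in> A" "b \<in> A" "a \<noteq> b" for a b
      using that \<open>\<And>a b. \<lbrakk>a \<in> A; b \<in> A; a \<noteq> b; ?h (int a - int b) \<le> ?n / 4\<rbrakk> \<Longrightarrow> thesis\<close> by force
    have "?n * ((?n - 1) * (?n / 4)) = (\<Sum>a\<in>A. \<Sum>b\<in>A - {a}. ?n / 4)"
      using assms by (simp add: card_Diff_singleton of_nat_diff)
    also have "\<dots> \<le> (\<Sum>a\<in>A. \<Sum>b\<in>A - {a}. ?h (int a - int b))"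
      by (intro sum_mono) (use big in force)
    also have "\<dots> \<le> (\<Sum>a\<in>A. \<Sum>b\<in>A. ?h (int a - int b))"
      using assms by (intro sum_mono sum_mono2 defect_nonneg A) auto
    also have "\<dots> < ?n ^ 3 / 16"
      using E sum_defect_eq[of 0 A 0] by simp
    finally have "?n * ?n * (?n - 1) < ?n * ?n * (?n / 4)"
      by (simp add: power3_eq_cube algebra_simps)
    then have "?n - 1 < ?n / 4" using assms by (simp add: mult_less_cancel_left_pos)
    then show False using assms by simp
  qed
  (* No two elements of A differ by k or more. *)
  define k where "k = Suc (Max A)"
  have "?h (int k * (int a - int b)) \<le> ?n / 4"
    using E ab by (intro defect_multiples_small[OF A, of 0]) auto
  then have "matches 0 A (int k * (int a - int b)) \<noteq> 0"
    using assms by (auto simp: defect_def)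
  then obtain c d where cd: "c \<in> A" "d \<in> A" "hit 0 (int k * (int a - int b)) c d \<noteq> 0"
    unfolding matches_def by (metis (no_types, lifting) sum.neutral)
  then have eq: "int d - int c = int k * (int a - int b)" by (auto simp: hit_def)
  have "c < k" "d < k" using cd assms by (auto simp: k_def less_Suc_eq_le)
  then have "\<bar>int d - int c\<bar> < int k" by auto
  moreover have "int k * 1 \<le> \<bar>int k * (int a - int b)\<bar>"
    using ab unfolding abs_mult by (intro mult_mono) auto
  ultimately show False using eq by simp
qed

text \<open>
  Otherwise \<open>1\<close> is an almost period, and hence so is every residue. The average of \<open>matches\<close>
  over all residues is \<open>n\<^sup>2 / M\<close>, which would be at least \<open>3 / 4 * n\<close>,
  against the assumed density of \<open>A\<close>.
\<close>

lemma energy_mod_gap: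
  assumes A: "A \<subseteq> {..<M}" "A \<noteq> {}" "4 * card A < 3 * M" and s: "\<bar>s\<bar> = 1"
  shows "energy (int M) A s \<le> 15 / 16 * real (card A) ^ 3"
proof (rule ccontr)
  let ?n = "real (card A)" and ?h = "defect (int M) A"
  assume "\<not> ?thesis"
  then have E: "15 / 16 * ?n ^ 3 \<le> energy (int M) A s" by simp
  have fin: "finite A" using A finite_subset by blast
  have sep: "separated (int M) A" by (rule separated_lessThan[OF A(1)])
  have "?h 1 = ?h s" using s defect_uminus[of "int M" A 1] by (auto simp: abs_if split: if_splits)
  also have "\<dots> \<le> 3 / 16 * ?n" by (rule defect_shift_small[OF sep A(2) E])
  finally have "?h 1 \<le> ?n / 4" by simp
  then have all: "?h (int k) \<le> ?n / 4" for k
    using defect_multiples_small[OF sep A(2) E, of 1 k] by simp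
  have "M * (3 / 4 * ?n) = (\<Sum>k<M. 3 / 4 * ?n)" by simp
  also have "\<dots> \<le> (\<Sum>k<M. matches (int M) A (int k))"
    using all by (intro sum_mono) (simp add: defect_def)
  also have "\<dots> = (\<Sum>k<M. \<Sum>c\<in>A. \<Sum>d\<in>A. hit (int M) (int k) c d)"
    by (simp add: matches_def)
  also have "\<dots> = (\<Sum>c\<in>A. \<Sum>k<M. \<Sum>d\<in>A. hit (int M) (int k) c d)"
    by (rule sum.swap)
  also have "\<dots> = (\<Sum>c\<in>A. \<Sum>d\<in>A. \<Sum>k<M. hit (int M) (int k) c d)"
    by (intro sum.cong refl sum.swap)
  also have "\<dots> \<le> (\<Sum>c\<in>A. \<Sum>d\<in>A. 1)"
  proof (intro sum_mono)
    fix c d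
    show "(\<Sum>k<M. hit (int M) (int k) c d) \<le> 1"
      unfolding hit_def
    proof (rule sum_of_bool_le_1)
      fix x y
      assume xy: "x \<in> {..<M}" "y \<in> {..<M}"
        "int M dvd int c - int d + int x" "int M dvd int c - int d + int y"
      have "int M dvd int x - int y" using dvd_diff[OF xy(3,4)] by simp
      then have "int x mod int M = int y mod int M" by (simp add: mod_eq_dvd_iff)
      then show "x = y" using xy by simp
    qed simp
  qed
  finally have "?n * (3 / 4 * M) \<le> ?n * ?n" by (simp add: algebra_simps)
  moreover have "?n > 0" using A fin by (simp add: card_gt_0_iff)
  ultimately have "3 / 4 * real M \<le> ?n" by (simp add: mult_le_cancel_left_pos)
  then show False using A(3) by linarith
qed

section \<open>Additive energy of Cantor sets\<close>

lemma sum_lessThan_add: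
  fixes f :: "nat \<Rightarrow> 'a::comm_monoid_add"
  shows "(\<Sum>j<k + l. f j) = (\<Sum>j<k. f j) + (\<Sum>j<l. f (k + j))"
  by (induction l) (simp_all add: add.assoc)

lemma cantor_set_0: "cantor_set M A 0 = {0}"
  by (auto simp: cantor_set_def)

lemma cantor_set_1: "cantor_set M A 1 = A"
proof -
  have "cantor_set M A 1 = {a 0 | a. a (0::nat) \<in> A}"
    by (simp add: cantor_set_def)
  also have "\<dots> = A"
    by (auto intro!: exI[of _ "\<lambda>_. x" for x])
  finally show ?thesis .
qed

lemma cantor_set_add:
  "cantor_set M A (k + l) = (\<lambda>(x, y). x + M ^ k * y) ` (cantor_set M A k \<times> cantor_set M A l)"
  (is "?L = ?R")
proof
  show "?L \<subseteq> ?R"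
  proof
    fix z assume "z \<in> ?L"
    then obtain a where a: "z = (\<Sum>j<k + l. a j * M ^ j)" "\<forall>j<k + l. a j \<in> A"
      by (auto simp: cantor_set_def)
    have "z = (\<Sum>j<k. a j * M ^ j) + M ^ k * (\<Sum>j<l. a (k + j) * M ^ j)"
      by (simp add: a sum_lessThan_add sum_distrib_left power_add algebra_simps)
    moreover have "(\<Sum>j<k. a j * M ^ j) \<in> cantor_set M A k"
      using a(2) by (auto simp: cantor_set_def)
    moreover have "(\<Sum>j<l. a (k + j) * M ^ j) \<in> cantor_set M A l"
      using a(2) by (auto simp: cantor_set_def intro!: exI[of _ "\<lambda>j. a (k + j)"])
    ultimately show "z \<in> ?R" by auto
  qed
  show "?R \<subseteq> ?L"
  proof clarify
    fix x y assume "x \<in> cantor_set M A k" "y \<in> cantor_set M A l"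
    then obtain a b where ab: "x = (\<Sum>j<k. a j * M ^ j)" "\<forall>j<k. a j \<in> A"
      "y = (\<Sum>j<l. b j * M ^ j)" "\<forall>j<l. b j \<in> A"
      by (auto simp: cantor_set_def)
    define c where "c j = (if j < k then a j else b (j - k))" for j
    have "x + M ^ k * y = (\<Sum>j<k + l. c j * M ^ j)"
      by (simp add: ab c_def sum_lessThan_add sum_distrib_left power_add algebra_simps)
    moreover have "\<forall>j<k + l. c j \<in> A" using ab by (auto simp: c_def)
    ultimately show "x + M ^ k * y \<in> ?L" by (auto simp: cantor_set_def)
  qed
qed

lemma add_mult_less:
  fixes x y m n :: nat
  assumes "x < m" "y < n"
  shows "x + m * y < m * n"
proof -
  have "x + m * y < m * Suc y" using assms by simp
  also have "\<dots> \<le> m * n" using assms by (intro mult_left_mono) auto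
  finally show ?thesis .
qed

lemma add_mult_div_mod:
  fixes x y m :: nat
  assumes "x < m"
  shows "(x + m * y) div m = y" "(x + m * y) mod m = x"
proof -
  have "m \<noteq> 0" using assms by simp
  then show "(x + m * y) div m = y" "(x + m * y) mod m = x" using assms by simp_all
qed

lemma cantor_set_less:
  assumes "A \<subseteq> {..<M}"
  shows "cantor_set M A k \<subseteq> {..<M ^ k}"
proof (induction k)
  case 0
  show ?case by (simp add: cantor_set_0)
next
  case (Suc k)
  have "x + M ^ k * y < M ^ k * M" if "x \<in> cantor_set M A k" "y \<in> A" for x y
    using that Suc assms by (intro add_mult_less) auto
  then have "(\<lambda>(x, y). x + M ^ k * y) ` (cantor_set M A k \<times> cantor_set M A 1) \<subseteq> {..<M ^ Suc k}"
    unfolding cantor_set_1 by (auto simp: mult.commute)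
  then show ?case unfolding cantor_set_add[symmetric] by simp
qed

lemma finite_cantor_set: "A \<subseteq> {..<M} \<Longrightarrow> finite (cantor_set M A k)"
  by (rule finite_subset[OF cantor_set_less finite_lessThan])

lemma sum_cantor_set_add:
  assumes "A \<subseteq> {..<M}"
  shows "(\<Sum>z\<in>cantor_set M A (k + l). f z)
    = (\<Sum>x\<in>cantor_set M A k. \<Sum>y\<in>cantor_set M A l. f (x + M ^ k * y))"
proof -
  have "inj_on (\<lambda>(x, y). x + M ^ k * y) (cantor_set M A k \<times> cantor_set M A l)"
  proof (rule inj_onI, clarify)
    fix x y x' y'
    assume "x \<in> cantor_set M A k" "x' \<in> cantor_set M A k" and eq: "x + M ^ k * y = x' + M ^ k * y'"
    then have lt: "x < M ^ k" "x' < M ^ k" using cantor_set_less[OF assms] by auto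
    show "x = x' \<and> y = y'"
      using add_mult_div_mod[OF lt(1), of y] add_mult_div_mod[OF lt(2), of y'] eq by simp
  qed
  then show ?thesis
    unfolding cantor_set_add by (subst sum.reindex) (auto simp: sum.cartesian_product intro!: sum.cong)
qed

text \<open>
  The carry rule: with \<open>v\<close> the incoming shift at the lowest digit, the relation between the lowest
  digits holds modulo \<open>M\<close>, and its quotient by \<open>M\<close> is passed on to the higher digits.
\<close>

lemma hit_cantor_digit:
  assumes "M > 0"
  shows "hit (int M * m) (v + int M * t) (c + M * z) (d + M * w) =
    of_bool (int M dvd int c - int d + v) * hit m (t + (int c - int d + v) div int M) z w"
proof -
  have eq: "int (c + M * z) - int (d + M * w) + (v + int M * t)
      = (int c - int d + v) + int M * (int z - int w + t)"
    by (simp add: algebra_simps)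
  show ?thesis
  proof (cases "int M dvd int c - int d + v")
    case True
    then obtain q where q: "int c - int d + v = int M * q" by blast
    then have "(int c - int d + v) div int M = q" using assms by simp
    moreover have "int M * q + int M * (int z - int w + t) = int M * (int z - int w + (q + t))"
      by (simp add: algebra_simps)
    ultimately show ?thesis unfolding hit_def eq q using assms by (simp add: add.commute)
  next
    case False
    then have "\<not> int M dvd (int c - int d + v) + int M * (int z - int w + t)"
      by (simp add: dvd_add_left_iff)
    then have "\<not> int M * m dvd (int c - int d + v) + int M * (int z - int w + t)"
      using dvd_mult_left by blast
    then show ?thesis using False unfolding hit_def eq by simp
  qed
qed

lemma sum_swap_pairs:
  "(\<Sum>x\<in>X. \<Sum>y\<in>Y. \<Sum>c\<in>C. \<Sum>d\<in>D. f x y c d) =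
   (\<Sum>c\<in>C. \<Sum>d\<in>D. \<Sum>x\<in>X. \<Sum>y\<in>Y. f x y c d)"
proof -
  have "(\<Sum>p\<in>X \<times> Y. \<Sum>q\<in>C \<times> D. f (fst p) (snd p) (fst q) (snd q)) =
    (\<Sum>q\<in>C \<times> D. \<Sum>p\<in>X \<times> Y. f (fst p) (snd p) (fst q) (snd q))"
    by (rule sum.swap)
  then show ?thesis by (simp add: sum.cartesian_product' )
qed

lemma sum_cantor_set_Suc_pairs:
  assumes "A \<subseteq> {..<M}"
  shows "(\<Sum>x\<in>cantor_set M A (Suc k). \<Sum>y\<in>cantor_set M A (Suc k). f x y) =
    (\<Sum>a\<in>A. \<Sum>b\<in>A. \<Sum>x\<in>cantor_set M A k. \<Sum>y\<in>cantor_set M A k. f (a + M * x) (b + M * y))"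
proof -
  have *: "(\<Sum>z\<in>cantor_set M A (Suc k). g z) = (\<Sum>a\<in>A. \<Sum>x\<in>cantor_set M A k. g (a + M * x))"
    for g :: "nat \<Rightarrow> 'a"
    using sum_cantor_set_add[OF assms, of g 1 k] by (simp add: cantor_set_1 plus_1_eq_Suc del: One_nat_def)
  show ?thesis unfolding * by (intro sum.cong refl sum.swap)
qed

lemma energy_cantor_Suc:
  assumes A: "A \<subseteq> {..<M}" and M: "M > 0"
  shows "energy (int M ^ Suc k) (cantor_set M A (Suc k)) s =
    (\<Sum>a\<in>A. \<Sum>b\<in>A. \<Sum>c\<in>A. \<Sum>d\<in>A.
      of_bool (int M dvd int c - int d + (int a - int b + s)) *
      energy (int M ^ k) (cantor_set M A k) ((int c - int d + (int a - int b + s)) div int M))"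
    (is "?L = (\<Sum>a\<in>A. \<Sum>b\<in>A. \<Sum>c\<in>A. \<Sum>d\<in>A. ?D a b c d * _ ((?v a b c d) div _))")
proof -
  let ?C = "cantor_set M A k"
  have m: "matches (int M ^ Suc k) (cantor_set M A (Suc k)) (int (a + M * x) - int (b + M * y) + s)
      = (\<Sum>c\<in>A. \<Sum>d\<in>A. ?D a b c d * matches (int M ^ k) ?C (int x - int y + ?v a b c d div int M))"
    for a b x y
  proof -
    have "int (a + M * x) - int (b + M * y) + s = (int a - int b + s) + int M * (int x - int y)"
      by (simp add: algebra_simps)
    then show ?thesis
      unfolding matches_def sum_cantor_set_Suc_pairs[OF A]
      by (simp only: hit_cantor_digit[OF M] power_Suc sum_distrib_left)
  qed
  show ?thesis
    unfolding energy_def sum_cantor_set_Suc_pairs[OF A] m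
    by (subst sum_swap_pairs) (simp only: sum_distrib_left)
qed

lemma energy_unfold:
  "energy m A s =
    (\<Sum>a\<in>A. \<Sum>b\<in>A. \<Sum>c\<in>A. \<Sum>d\<in>A. of_bool (m dvd int c - int d + (int a - int b + s)))"
  by (simp add: energy_def matches_def hit_def)

text \<open>
  Induction on the number of digits with the weights \<open>1\<close> for carry \<open>0\<close> and \<open>31 / 32\<close> for the carries
  \<open>1\<close> and \<open>- 1\<close>. From carry \<open>0\<close> at most \<open>15 / 16\<close> of the triples lead to carry \<open>0\<close> and the remaining
  ones at best to the lower weight, so the weight is multiplied by at most
  \<open>15 / 16 + 1 / 16 * (31 / 32) = 511 / 512\<close>. From carry \<open>1\<close> or \<open>- 1\<close> at most \<open>15 / 16\<close> of the triples
  survive, and \<open>15 / 16 \<le> 31 / 32 * (511 / 512)\<close>. The factor \<open>2\<close> in \<open>B\<close> only serves to start the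
  induction, where all three counts are \<open>1\<close>.
\<close>

lemma energy_cantor_le:
  fixes A :: "nat set"
  assumes A: "A \<subseteq> {..<M}" "2 \<le> card A" "4 * card A < 3 * M"
  defines "B \<equiv> \<lambda>k. 2 * (511 / 512 * real (card A) ^ 3) ^ k"
  shows "energy (int M ^ k) (cantor_set M A k) 0 \<le> B k \<and>
    (\<forall>s. \<bar>s\<bar> = 1 \<longrightarrow> energy (int M ^ k) (cantor_set M A k) s \<le> 31 / 32 * B k)"
proof (induction k)
  case 0
  have "energy (int M ^ 0) (cantor_set M A 0) s = 1" for s
    by (simp add: energy_unfold cantor_set_0)
  then show ?case by (simp add: B_def)
next
  case (Suc k)
  let ?n = "real (card A)" and ?E = "energy (int M ^ k) (cantor_set M A k)"
  have fin: "finite A" "A \<noteq> {}" and M: "M > 0" using A finite_subset by (blast, auto)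
  have sep: "separated (int M) A"
    by (rule separated_lessThan[OF A(1)])
  have B0: "0 \<le> B k" by (simp add: B_def)
  (* A digit relation v = M * t has |t| at most 1, with weight 31/32 if M divides v, topped up
     to 1 if v = 0. *)
  have F: "of_bool (int M dvd v) * ?E (v div int M)
      \<le> B k * (1 / 32 * of_bool (0 dvd v) + 31 / 32 * of_bool (int M dvd v))"
    if v: "\<bar>v\<bar> < 2 * int M" for v
  proof (cases "int M dvd v")
    case True
    then obtain t where t: "v = int M * t" by blast
    have "int M * \<bar>t\<bar> < int M * 2" using v t by (simp add: abs_mult)
    then have "\<bar>t\<bar> < 2" using M by simp
    then consider "t = 0" | "\<bar>t\<bar> = 1" by linarith
    then show ?thesis
    proof cases
      case 1
      then show ?thesis using Suc t by simp
    next
      case 2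
      then have "?E t \<le> 31 / 32 * B k" using Suc by blast
      then show ?thesis using 2 t M by auto
    qed
  qed auto
  have bnd: "\<bar>int c - int d + (int a - int b + s)\<bar> < 2 * int M"
    if "a \<in> A" "b \<in> A" "c \<in> A" "d \<in> A" "\<bar>s\<bar> \<le> 1" for a b c d s
  proof -
    have "a < M" "b < M" "c < M" "d < M" using that A by auto
    then show ?thesis using that(5) by linarith
  qed
  have step: "energy (int M ^ Suc k) (cantor_set M A (Suc k)) s
      \<le> B k * (1 / 32 * energy 0 A s + 31 / 32 * energy (int M) A s)" if "\<bar>s\<bar> \<le> 1" for s
  proof -
    have "energy (int M ^ Suc k) (cantor_set M A (Suc k)) s \<le>
      (\<Sum>a\<in>A. \<Sum>b\<in>A. \<Sum>c\<in>A. \<Sum>d\<in>A.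
        B k * (1 / 32 * of_bool (0 dvd int c - int d + (int a - int b + s)) +
          31 / 32 * of_bool (int M dvd int c - int d + (int a - int b + s))))"
      unfolding energy_cantor_Suc[OF A(1) M] by (intro sum_mono F bnd that)
    also have "\<dots> = B k * (1 / 32 * energy 0 A s + 31 / 32 * energy (int M) A s)"
      unfolding energy_unfold distrib_left sum.distrib sum_distrib_left ..
    finally show ?thesis .
  qed
  have gap: "energy (int M) A s \<le> 15 / 16 * ?n ^ 3" if "\<bar>s\<bar> = 1" for s
    by (rule energy_mod_gap[OF A(1) fin(2) A(3) that])
  have le: "energy 0 A s \<le> energy (int M) A s" for s
    unfolding energy_unfold by (intro sum_mono) auto
  have 1: "1 / 32 * energy 0 A s + 31 / 32 * energy (int M) A s \<le> 15 / 16 * ?n ^ 3"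
    if "\<bar>s\<bar> = 1" for s
    using le[of s] gap[OF that] by linarith
  have "energy 0 A 0 \<le> 15 / 16 * ?n ^ 3" by (rule energy_int_gap[OF fin(1) A(2)])
  moreover have "energy (int M) A 0 \<le> ?n ^ 3" by (rule energy_le_card_cubed[OF sep])
  ultimately have 0: "1 / 32 * energy 0 A 0 + 31 / 32 * energy (int M) A 0 \<le> 511 / 512 * ?n ^ 3"
    by linarith
  have "energy (int M ^ Suc k) (cantor_set M A (Suc k)) 0 \<le> B k * (511 / 512 * ?n ^ 3)"
    using order_trans[OF step mult_left_mono[OF 0 B0]] by simp
  moreover have "energy (int M ^ Suc k) (cantor_set M A (Suc k)) s \<le> 31 / 32 * (B k * (511 / 512 * ?n ^ 3))"
    if "\<bar>s\<bar> = 1" for s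
  proof -
    have "energy (int M ^ Suc k) (cantor_set M A (Suc k)) s \<le> B k * (15 / 16 * ?n ^ 3)"
      using order_trans[OF step mult_left_mono[OF 1 B0]] that by simp
    also have "\<dots> \<le> 31 / 32 * (B k * (511 / 512 * ?n ^ 3))"
    proof -
      have "0 \<le> B k * ?n ^ 3" using B0 by simp
      then show ?thesis by simp
    qed
    finally show ?thesis .
  qed
  moreover have "B (Suc k) = B k * (511 / 512 * ?n ^ 3)" by (simp add: B_def)
  ultimately show ?case by metis
qed

section \<open>Additive energy bounds the restricted Fourier transform\<close>

definition wave :: "nat \<Rightarrow> int \<Rightarrow> complex" where
  "wave N x = cis (2 * pi * of_int x / of_nat N)"

definition fourier_sum :: "nat \<Rightarrow> nat set \<Rightarrow> (nat \<Rightarrow> complex) \<Rightarrow> nat \<Rightarrow> complex" where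
  "fourier_sum N C u j = (\<Sum>l\<in>C. wave N (- (int j * int l)) * u l)"

lemma wave_add: "wave N (x + y) = wave N x * wave N y"
  by (simp add: wave_def cis_mult add_divide_distrib distrib_left)

lemma wave_uminus: "wave N (- x) = cnj (wave N x)"
  by (simp add: wave_def cis_cnj)

lemma norm_wave [simp]: "cmod (wave N x) = 1"
  by (simp add: wave_def)

lemma wave_mult_cancel: "m > 0 \<Longrightarrow> wave (N * m) (int m * x) = wave N x"
  unfolding wave_def by (rule arg_cong[of _ _ cis]) simp

lemma wave_power: "wave N v ^ x = wave N (int x * v)"
  unfolding wave_def Complex.DeMoivre by (rule arg_cong[of _ _ cis]) (simp add: mult_ac)

lemma wave_eq_1_iff:
  assumes "N > 0"
  shows "wave N x = 1 \<longleftrightarrow> int N dvd x"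
proof
  assume "wave N x = 1"
  then obtain n :: int where n: "2 * pi * of_int x / of_nat N = of_int (2 * n) * pi"
    unfolding wave_def cis_conv_exp exp_eq_1 by auto
  then have "real_of_int x = real_of_int (n * int N)"
    using assms by (simp add: field_simps)
  then have "x = n * int N" by (simp only: of_int_eq_iff)
  then show "int N dvd x" by simp
next
  assume "int N dvd x"
  then obtain n where "x = int N * n" by blast
  then have "2 * pi * of_int x / of_nat N = 2 * pi * of_int n" using assms by simp
  then show "wave N x = 1"
    unfolding wave_def by (simp only: cis_multiple_2pi Ints_of_int)
qed

lemma wave_cong:
  assumes "N > 0" "int N dvd x - y"
  shows "wave N x = wave N y"
proof -
  have "wave N x = wave N ((x - y) + y)" by simp
  also have "\<dots> = wave N y" unfolding wave_add using assms by (simp add: wave_eq_1_iff)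
  finally show ?thesis .
qed

lemma sum_wave:
  assumes N: "N > 0"
  shows "(\<Sum>x<N. wave N (int x * v)) = of_nat N * of_bool (int N dvd v)"
proof (cases "int N dvd v")
  case True
  then have "wave N v = 1" using N by (simp add: wave_eq_1_iff)
  then show ?thesis using True by (simp flip: wave_power)
next
  case False
  then have "wave N v \<noteq> 1" using N by (simp add: wave_eq_1_iff)
  moreover have "wave N v ^ N = 1" unfolding wave_power using N by (simp add: wave_eq_1_iff)
  ultimately show ?thesis using False by (simp add: geometric_sum flip: wave_power)
qed

lemma sum_hit_shift:
  assumes N: "N > 0" and f: "\<And>x y. int N dvd x - y \<Longrightarrow> f x = f y"
  shows "(\<Sum>x<N. hit (int N) (int x) l m * f (int x)) = (f (int m - int l) :: real)"
proof -
  let ?y = "(int m - int l) mod int N"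
  have y: "0 \<le> ?y" "?y < int N" using N by auto
  have "hit (int N) (int x) l m = of_bool (x = nat ?y)" if "x < N" for x
  proof -
    have "int N dvd int l - int m + int x \<longleftrightarrow> int x mod int N = ?y"
      unfolding mod_eq_dvd_iff by (simp add: algebra_simps)
    also have "\<dots> \<longleftrightarrow> int x = ?y" using that by simp
    also have "\<dots> \<longleftrightarrow> x = nat ?y" using y by linarith
    finally show ?thesis by (simp add: hit_def)
  qed
  then have "(\<Sum>x<N. hit (int N) (int x) l m * f (int x)) = (\<Sum>x<N. of_bool (x = nat ?y) * f (int x))"
    by (intro sum.cong) auto
  also have "\<dots> = (\<Sum>x\<in>{nat ?y}. f (int x))"
    using y by (intro sum.mono_neutral_cong_right) auto
  also have "\<dots> = f ?y" using y by simp
  also have "\<dots> = f (int m - int l)" by (rule f) (simp add: mod_eq_dvd_iff[symmetric])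
  finally show ?thesis .
qed

text \<open>
  Grouping pairs by their difference: \<open>matches\<close> counts the representations of a residue.
\<close>

lemma sum_differences_eq:
  assumes N: "N > 0" and f: "\<And>x y. int N dvd x - y \<Longrightarrow> f x = f y"
  shows "(\<Sum>l\<in>C. \<Sum>m\<in>C. f (int m - int l)) = (\<Sum>x<N. matches (int N) C (int x) * (f (int x) :: real))"
proof -
  have "(\<Sum>l\<in>C. \<Sum>m\<in>C. f (int m - int l)) =
      (\<Sum>l\<in>C. \<Sum>m\<in>C. \<Sum>x<N. hit (int N) (int x) l m * f (int x))"
    by (simp only: sum_hit_shift[of N f, OF N f])
  also have "\<dots> = (\<Sum>l\<in>C. \<Sum>x<N. \<Sum>m\<in>C. hit (int N) (int x) l m * f (int x))"
    by (intro sum.cong refl sum.swap)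
  also have "\<dots> = (\<Sum>x<N. \<Sum>l\<in>C. \<Sum>m\<in>C. hit (int N) (int x) l m * f (int x))"
    by (rule sum.swap)
  finally show ?thesis by (simp add: matches_def sum_distrib_right)
qed

lemma sum_matches_squared:
  assumes "N > 0"
  shows "(\<Sum>x<N. matches (int N) C (int x) ^ 2) = energy (int N) C 0"
proof -
  have "(\<Sum>x<N. matches (int N) C (int x) ^ 2) = (\<Sum>l\<in>C. \<Sum>m\<in>C. matches (int N) C (int m - int l))"
    unfolding power2_eq_square
    by (rule sum_differences_eq[symmetric, OF assms matches_cong])
  also have "\<dots> = energy (int N) C 0"
    unfolding energy_def by (subst sum.swap) simp
  finally show ?thesis .
qed

definition expsum :: "nat \<Rightarrow> nat set \<Rightarrow> int \<Rightarrow> complex" where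
  "expsum N C v = (\<Sum>j\<in>C. wave N (int j * v))"

text \<open>
  Expanding the fourth power and summing over all frequencies, orthogonality of the characters
  selects the quadruples counted by the energy.
\<close>

lemma sum_expsum_fourth_power:
  assumes N: "N > 0"
  shows "(\<Sum>x<N. cmod (expsum N C (int x)) ^ 4) = N * energy (int N) C 0"
proof -
  define D where "D p = int (fst p) - int (snd p)" for p :: "nat \<times> nat"
  have sq: "complex_of_real (cmod (expsum N C v) ^ 2) = (\<Sum>p\<in>C \<times> C. wave N (v * D p))" for v
  proof -
    have "complex_of_real (cmod (expsum N C v) ^ 2) = expsum N C v * cnj (expsum N C v)"
      by (rule complex_norm_square)
    also have "\<dots> = (\<Sum>a\<in>C. \<Sum>b\<in>C. wave N (int a * v) * wave N (- (int b * v)))"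
      by (simp add: expsum_def sum_product wave_uminus)
    also have "\<dots> = (\<Sum>p\<in>C \<times> C. wave N (v * D p))"
      by (simp add: sum.cartesian_product D_def algebra_simps case_prod_beta flip: wave_add)
    finally show ?thesis .
  qed
  have "complex_of_real (\<Sum>x<N. cmod (expsum N C (int x)) ^ 4) =
      (\<Sum>x<N. complex_of_real (cmod (expsum N C (int x)) ^ 2) ^ 2)"
    by (simp flip: power_mult)
  also have "\<dots> = (\<Sum>x<N. \<Sum>p\<in>C \<times> C. \<Sum>q\<in>C \<times> C. wave N (int x * (D p + D q)))"
    unfolding sq by (simp add: power2_eq_square sum_product distrib_left flip: wave_add)
  also have "\<dots> = (\<Sum>p\<in>C \<times> C. \<Sum>x<N. \<Sum>q\<in>C \<times> C. wave N (int x * (D p + D q)))"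
    by (rule sum.swap)
  also have "\<dots> = (\<Sum>p\<in>C \<times> C. \<Sum>q\<in>C \<times> C. \<Sum>x<N. wave N (int x * (D p + D q)))"
    by (intro sum.cong refl sum.swap)
  also have "\<dots> = (\<Sum>p\<in>C \<times> C. \<Sum>q\<in>C \<times> C. complex_of_real (real N * of_bool (int N dvd D q + D p)))"
    unfolding sum_wave[OF N] by (intro sum.cong refl) (simp add: of_bool_def add.commute)
  also have "\<dots> = complex_of_real (\<Sum>p\<in>C \<times> C. \<Sum>q\<in>C \<times> C. real N * of_bool (int N dvd D q + D p))"
    by (simp only: of_real_sum)
  also have "(\<Sum>p\<in>C \<times> C. \<Sum>q\<in>C \<times> C. real N * of_bool (int N dvd D q + D p)) = N * energy (int N) C 0"
    unfolding energy_unfold by (simp add: sum.cartesian_product' D_def sum_distrib_left)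
  finally show ?thesis by (simp only: of_real_eq_iff)
qed

text \<open>
  The quadratic form on the left is that of the kernel \<open>expsum N C (m - l)\<close> on \<open>C \<times> C\<close>, so it is at
  most \<open>sqrt W\<close> times the squared norm of \<open>u\<close>, where \<open>W\<close> is the squared Hilbert--Schmidt norm of the
  kernel. Grouping the pairs in \<open>W\<close> by difference and applying Cauchy--Schwarz separates the number
  of representations, with square sum \<open>energy N C 0\<close>, from the fourth powers of the exponential
  sums, with sum \<open>N * energy N C 0\<close>.
\<close>

lemma fourier_energy_bound:
  assumes C: "C \<subseteq> {..<N}" and N: "N > 0"
  shows "(\<Sum>j\<in>C. cmod (fourier_sum N C u j) ^ 2)
    \<le> sqrt (sqrt N * energy (int N) C 0) * (\<Sum>l\<in>C. cmod (u l) ^ 2)"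
proof -
  let ?S = "expsum N C" and ?U = "\<Sum>l\<in>C. cmod (u l) ^ 2"
  define W where "W = (\<Sum>l\<in>C. \<Sum>m\<in>C. cmod (?S (int m - int l)) ^ 2)"
  have E0: "0 \<le> energy (int N) C 0"
    unfolding energy_unfold by (intro sum_nonneg) auto
  have "W = (\<Sum>x<N. matches (int N) C (int x) * cmod (?S (int x)) ^ 2)"
    unfolding W_def
  proof (rule sum_differences_eq[OF N])
    fix x y :: int assume "int N dvd x - y"
    then have "wave N (int j * x) = wave N (int j * y)" for j
      by (intro wave_cong N) (simp flip: right_diff_distrib)
    then show "cmod (?S x) ^ 2 = cmod (?S y) ^ 2" by (simp add: expsum_def)
  qed
  then have "W ^ 2 \<le> (\<Sum>x<N. matches (int N) C (int x) ^ 2) * (\<Sum>x<N. (cmod (?S (int x)) ^ 2) ^ 2)"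
    by (simp only: Cauchy_Schwarz_ineq_sum)
  also have "\<dots> = energy (int N) C 0 * (N * energy (int N) C 0)"
    by (simp add: sum_matches_squared[OF N] sum_expsum_fourth_power[OF N] flip: power_mult)
  also have "\<dots> = (sqrt N * energy (int N) C 0) ^ 2"
    by (simp add: power_mult_distrib power2_eq_square)
  finally have W: "W \<le> sqrt N * energy (int N) C 0"
    by (rule power2_le_imp_le) (use E0 in simp)
  have "complex_of_real (\<Sum>j\<in>C. cmod (fourier_sum N C u j) ^ 2) =
      (\<Sum>j\<in>C. fourier_sum N C u j * cnj (fourier_sum N C u j))"
    by (simp only: of_real_sum complex_norm_square)
  also have "\<dots> = (\<Sum>j\<in>C. \<Sum>l\<in>C. \<Sum>m\<in>C. u l * cnj (u m) * wave N (int j * (int m - int l)))"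
  proof (intro sum.cong refl)
    fix j
    have "wave N (int j * (int m - int l)) = wave N (- (int j * int l)) * wave N (int j * int m)" for l m
      by (simp add: algebra_simps flip: wave_add)
    then show "fourier_sum N C u j * cnj (fourier_sum N C u j) =
        (\<Sum>l\<in>C. \<Sum>m\<in>C. u l * cnj (u m) * wave N (int j * (int m - int l)))"
      by (simp add: fourier_sum_def sum_product wave_uminus algebra_simps)
  qed
  also have "\<dots> = (\<Sum>l\<in>C. \<Sum>j\<in>C. \<Sum>m\<in>C. u l * cnj (u m) * wave N (int j * (int m - int l)))"
    by (rule sum.swap)
  also have "\<dots> = (\<Sum>l\<in>C. \<Sum>m\<in>C. \<Sum>j\<in>C. u l * cnj (u m) * wave N (int j * (int m - int l)))"
    by (intro sum.cong refl sum.swap)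
  also have "\<dots> = (\<Sum>l\<in>C. \<Sum>m\<in>C. u l * cnj (u m) * ?S (int m - int l))"
    by (simp add: expsum_def sum_distrib_left)
  also have "\<dots> = (\<Sum>p\<in>C \<times> C. u (fst p) * cnj (u (snd p)) * ?S (int (snd p) - int (fst p)))"
    by (simp add: sum.cartesian_product case_prod_beta)
  finally have eq: "complex_of_real (\<Sum>j\<in>C. cmod (fourier_sum N C u j) ^ 2) =
    (\<Sum>p\<in>C \<times> C. u (fst p) * cnj (u (snd p)) * ?S (int (snd p) - int (fst p)))" .
  have "(\<Sum>j\<in>C. cmod (fourier_sum N C u j) ^ 2) = cmod (complex_of_real (\<Sum>j\<in>C. cmod (fourier_sum N C u j) ^ 2))"
    by (subst norm_of_real) (simp add: sum_nonneg)
  also have "\<dots> \<le> (\<Sum>p\<in>C \<times> C. (cmod (u (fst p)) * cmod (u (snd p))) * cmod (?S (int (snd p) - int (fst p))))"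
    unfolding eq by (rule order_trans[OF norm_sum]) (simp add: norm_mult)
  finally have "(\<Sum>j\<in>C. cmod (fourier_sum N C u j) ^ 2) ^ 2 \<le>
      (\<Sum>p\<in>C \<times> C. (cmod (u (fst p)) * cmod (u (snd p))) * cmod (?S (int (snd p) - int (fst p)))) ^ 2"
    by (intro power_mono) (simp_all add: sum_nonneg)
  also have "\<dots> \<le> (\<Sum>p\<in>C \<times> C. (cmod (u (fst p)) * cmod (u (snd p))) ^ 2) *
      (\<Sum>p\<in>C \<times> C. cmod (?S (int (snd p) - int (fst p))) ^ 2)"
    by (rule Cauchy_Schwarz_ineq_sum)
  also have "(\<Sum>p\<in>C \<times> C. (cmod (u (fst p)) * cmod (u (snd p))) ^ 2) = ?U ^ 2"
    unfolding power2_eq_square[of ?U] sum_product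
    by (simp add: sum.cartesian_product case_prod_beta power_mult_distrib)
  also have "(\<Sum>p\<in>C \<times> C. cmod (?S (int (snd p) - int (fst p))) ^ 2) = W"
    by (simp add: W_def sum.cartesian_product case_prod_beta)
  also have "?U ^ 2 * W \<le> ?U ^ 2 * (sqrt N * energy (int N) C 0)"
    using W by (intro mult_left_mono) auto
  also have "\<dots> = (sqrt (sqrt N * energy (int N) C 0) * ?U) ^ 2"
    using E0 by (simp add: power_mult_distrib)
  finally show ?thesis
    by (rule power2_le_imp_le) (use E0 in \<open>auto intro!: sum_nonneg mult_nonneg_nonneg\<close>)
qed

abbreviation restricted_dft :: "nat \<Rightarrow> nat set \<Rightarrow> (nat \<Rightarrow> complex) \<Rightarrow> nat \<Rightarrow> complex" where
  "restricted_dft N C \<equiv> ind_mult C \<circ> dft N \<circ> ind_mult C"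

lemma ell2_norm_restricted_dft:
  assumes C: "C \<subseteq> {..<N}" and N: "N > 0"
  shows "ell2_norm N (restricted_dft N C u) ^ 2 = (\<Sum>j\<in>C. cmod (fourier_sum N C u j) ^ 2) / N"
proof -
  have val: "restricted_dft N C u j = indicator C j * (fourier_sum N C u j / complex_of_real (sqrt N))"
    if "j < N" for j
  proof -
    have "(\<Sum>l<N. exp (- 2 * complex_of_real pi * \<i> * of_nat j * of_nat l / of_nat N) * (indicator C l * u l))
      = fourier_sum N C u j"
      unfolding fourier_sum_def
    proof (rule sum.mono_neutral_cong_right)
      fix l assume "l \<in> C"
      have "exp (- 2 * complex_of_real pi * \<i> * of_nat j * of_nat l / of_nat N) =
          exp (\<i> * complex_of_real (2 * pi * of_int (- (int j * int l)) / real N))"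
        by (rule arg_cong[of _ _ exp]) (simp add: algebra_simps)
      then show "exp (- 2 * complex_of_real pi * \<i> * of_nat j * of_nat l / of_nat N) * (indicator C l * u l)
          = wave N (- (int j * int l)) * u l"
        unfolding wave_def cis_conv_exp using \<open>l \<in> C\<close> by simp
    qed (use C in auto)
    then show ?thesis using that by (simp add: ind_mult_def dft_def)
  qed
  have "ell2_norm N (restricted_dft N C u) ^ 2 = (\<Sum>j<N. cmod (restricted_dft N C u j) ^ 2)"
    by (simp add: ell2_norm_def L2_set_def sum_nonneg)
  also have "\<dots> = (\<Sum>j\<in>C. cmod (fourier_sum N C u j) ^ 2 / N)"
    using C by (intro sum.mono_neutral_cong_right)
      (auto simp: val subset_eq norm_divide power_divide simp del: comp_apply)
  finally show ?thesis by (simp add: sum_divide_distrib)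
qed

lemma ell2_norm_nonneg: "0 \<le> ell2_norm N u"
  by (simp add: ell2_norm_def)

lemma sum_le_ell2_norm_squared:
  assumes "C \<subseteq> {..<N}"
  shows "(\<Sum>l\<in>C. cmod (u l) ^ 2) \<le> ell2_norm N u ^ 2"
  using assms by (auto simp: ell2_norm_def L2_set_def sum_nonneg intro!: sum_mono2)

lemma ell2_norm_restricted_dft_le:
  assumes C: "C \<subseteq> {..<N}" and N: "N > 0" and B: "0 \<le> B"
    and bound: "(\<Sum>j\<in>C. cmod (fourier_sum N C u j) ^ 2) \<le> N * B ^ 2 * (\<Sum>l\<in>C. cmod (u l) ^ 2)"
    and u: "ell2_norm N u \<le> 1"
  shows "ell2_norm N (restricted_dft N C u) \<le> B"
proof -
  have "ell2_norm N u ^ 2 \<le> 1 ^ 2" using u ell2_norm_nonneg by (intro power_mono) auto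
  then have "(\<Sum>l\<in>C. cmod (u l) ^ 2) \<le> 1" using sum_le_ell2_norm_squared[OF C, of u] by simp
  then have "N * B ^ 2 * (\<Sum>l\<in>C. cmod (u l) ^ 2) \<le> N * B ^ 2 * 1"
    by (intro mult_left_mono) auto
  from order_trans[OF bound this] have "ell2_norm N (restricted_dft N C u) ^ 2 \<le> B ^ 2"
    unfolding ell2_norm_restricted_dft[OF C N] using N by (simp add: field_simps)
  then show ?thesis using B by (rule power2_le_imp_le)
qed

lemma zero_in_unit_ball: "(\<lambda>_. 0) \<in> {u \<in> ell2 N. ell2_norm N u \<le> 1}"
  by (simp add: ell2_def ell2_norm_def L2_set_def)

lemma opnorm_restricted_dft_le:
  assumes C: "C \<subseteq> {..<N}" and N: "N > 0" and B: "0 \<le> B"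
    and bound: "\<And>u. (\<Sum>j\<in>C. cmod (fourier_sum N C u j) ^ 2) \<le> N * B ^ 2 * (\<Sum>l\<in>C. cmod (u l) ^ 2)"
  shows "ell2_opnorm N (restricted_dft N C) \<le> B"
  unfolding ell2_opnorm_def
proof (rule cSUP_least)
  show "{u \<in> ell2 N. ell2_norm N u \<le> 1} \<noteq> {}" using zero_in_unit_ball by blast
qed (use ell2_norm_restricted_dft_le[OF C N B bound] in auto)

lemma bdd_above_restricted_dft:
  assumes C: "C \<subseteq> {..<N}" and N: "N > 0"
  shows "bdd_above ((\<lambda>u. ell2_norm N (restricted_dft N C u)) ` {u \<in> ell2 N. ell2_norm N u \<le> 1})"
proof -
  define B where "B = sqrt (sqrt (sqrt N * energy (int N) C 0) / N)"
  have "0 \<le> energy (int N) C 0"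
    unfolding energy_unfold by (intro sum_nonneg) auto
  then have B: "0 \<le> B" "N * B ^ 2 = sqrt (sqrt N * energy (int N) C 0)"
    using N by (simp_all add: B_def)
  have "ell2_norm N (restricted_dft N C u) \<le> B" if "ell2_norm N u \<le> 1" for u
    using that fourier_energy_bound[OF C N, of u] B
    by (intro ell2_norm_restricted_dft_le C N) auto
  then show ?thesis by (intro bdd_aboveI2) auto
qed

lemma opnorm_restricted_dft_nonneg:
  assumes C: "C \<subseteq> {..<N}" and N: "N > 0"
  shows "0 \<le> ell2_opnorm N (restricted_dft N C)"
  unfolding ell2_opnorm_def
  by (rule cSUP_upper2[OF bdd_above_restricted_dft[OF C N] zero_in_unit_ball ell2_norm_nonneg])

text \<open>
  The supremum in \<open>ell2_opnorm\<close> is a bound for every \<open>u\<close>, by restriction to \<open>C\<close> and normalisation.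
\<close>

lemma fourier_sum_le_opnorm:
  assumes C: "C \<subseteq> {..<N}" and N: "N > 0"
  shows "(\<Sum>j\<in>C. cmod (fourier_sum N C u j) ^ 2)
    \<le> N * ell2_opnorm N (restricted_dft N C) ^ 2 * (\<Sum>l\<in>C. cmod (u l) ^ 2)"
proof -
  let ?r = "ell2_opnorm N (restricted_dft N C)" and ?U = "\<Sum>l\<in>C. cmod (u l) ^ 2"
  have fin: "finite C" using C finite_subset by blast
  show ?thesis
  proof (cases "?U = 0")
    case True
    then have "u l = 0" if "l \<in> C" for l using that fin by (auto simp: sum_nonneg_eq_0_iff)
    then show ?thesis by (simp add: fourier_sum_def)
  next
    case False
    define t where "t = sqrt ?U"
    have t: "t > 0" "t ^ 2 = ?U" using False sum_nonneg[of C "\<lambda>l. cmod (u l) ^ 2"]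
      by (auto simp: t_def less_le)
    define v where "v l = (if l \<in> C then u l / t else 0)" for l
    have "ell2_norm N v ^ 2 = (\<Sum>l<N. cmod (v l) ^ 2)"
      by (simp add: ell2_norm_def L2_set_def sum_nonneg)
    also have "\<dots> = (\<Sum>l\<in>C. cmod (u l) ^ 2 / t ^ 2)"
      using C by (intro sum.mono_neutral_cong_right) (auto simp: v_def norm_divide power_divide)
    also have "\<dots> = 1 ^ 2" using t False by (simp flip: sum_divide_distrib)
    finally have "ell2_norm N v = 1" by (rule power2_eq_imp_eq) (simp_all add: ell2_norm_nonneg)
    then have "ell2_norm N v \<le> 1" by simp
    moreover have "v \<in> ell2 N" using C by (auto simp: ell2_def v_def)
    ultimately have "ell2_norm N (restricted_dft N C v) \<le> ?r"
      unfolding ell2_opnorm_def by (intro cSUP_upper bdd_above_restricted_dft C N) auto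
    then have "ell2_norm N (restricted_dft N C v) ^ 2 \<le> ?r ^ 2"
      by (intro power_mono ell2_norm_nonneg)
    then have "(\<Sum>j\<in>C. cmod (fourier_sum N C v j) ^ 2) \<le> N * ?r ^ 2"
      unfolding ell2_norm_restricted_dft[OF C N] using N by (simp add: field_simps)
    moreover have "fourier_sum N C v j = fourier_sum N C u j / t" for j
      by (simp add: fourier_sum_def v_def sum_divide_distrib cong: sum.cong)
    ultimately have "(\<Sum>j\<in>C. cmod (fourier_sum N C u j) ^ 2) / t ^ 2 \<le> N * ?r ^ 2"
      by (simp add: norm_divide power_divide sum_divide_distrib)
    then have "(\<Sum>j\<in>C. cmod (fourier_sum N C u j) ^ 2) \<le> N * ?r ^ 2 * t ^ 2"
      using t(1) by (simp add: pos_divide_le_eq)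
    then show ?thesis unfolding t(2) .
  qed
qed

lemma opnorm_restricted_dft_le_energy:
  assumes C: "C \<subseteq> {..<N}" and N: "N > 0"
  shows "ell2_opnorm N (restricted_dft N C) ^ 4 \<le> energy (int N) C 0 / (N * sqrt N)"
proof -
  define B where "B = sqrt (sqrt (sqrt N * energy (int N) C 0) / N)"
  have E: "0 \<le> energy (int N) C 0"
    unfolding energy_unfold by (intro sum_nonneg) auto
  then have B: "0 \<le> B" "N * B ^ 2 = sqrt (sqrt N * energy (int N) C 0)"
    using N by (simp_all add: B_def)
  have "ell2_opnorm N (restricted_dft N C) \<le> B"
    using fourier_energy_bound[OF C N] B by (intro opnorm_restricted_dft_le C N) auto
  then have "ell2_opnorm N (restricted_dft N C) ^ 4 \<le> B ^ 4"
    by (intro power_mono opnorm_restricted_dft_nonneg C N)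
  also have "B ^ 4 = (B ^ 2) ^ 2" by (simp flip: power_mult)
  also have "\<dots> = sqrt N * energy (int N) C 0 / N ^ 2"
    using E by (simp add: B_def power_divide)
  also have "\<dots> = energy (int N) C 0 / (N * sqrt N)"
    using N by (simp add: power2_eq_square field_simps)
  finally show ?thesis .
qed

section \<open>Submultiplicativity and the existence of the exponent\<close>

text \<open>
  Fekete's lemma: the limit is the infimum \<open>L\<close> of the quotients. If \<open>a m / m\<close> is close to \<open>L\<close>,
  writing \<open>k = q * m + r\<close> bounds \<open>a k\<close> by \<open>k * (a m / m)\<close> up to a constant \<open>B\<close> independent of \<open>k\<close>.
\<close>

lemma subadditive_imp_convergent:
  fixes a :: "nat \<Rightarrow> real"
  assumes sub: "\<And>k l. a (k + l) \<le> a k + a l"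
    and lower: "\<And>k. b * real k \<le> a k"
  shows "convergent (\<lambda>k. a k / real k)"
proof -
  define L where "L = (INF k\<in>{1..}. a k / real k)"
  have bdd: "bdd_below ((\<lambda>k. a k / real k) ` {1..})"
    by (rule bdd_belowI2[of _ b]) (use lower in \<open>auto simp: field_simps\<close>)
  have mult: "a (q * m + r) \<le> real q * a m + a r" for q m r
  proof (induction q)
    case (Suc q)
    have "a (Suc q * m + r) \<le> a m + a (q * m + r)"
      using sub[of m "q * m + r"] by (simp add: add.assoc)
    then show ?case using Suc by (simp add: algebra_simps)
  qed simp
  have "(\<lambda>k. a k / real k) \<longlonglongrightarrow> L"
  proof (rule LIMSEQ_I)
    fix e :: real assume e: "e > 0"
    have "Inf ((\<lambda>k. a k / real k) ` {1..}) < L + e / 2" using e by (simp add: L_def)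
    then have "\<exists>x\<in>(\<lambda>k. a k / real k) ` {1..}. x < L + e / 2"
      by (intro cInf_lessD) auto
    then obtain m where m: "m \<ge> 1" "a m / real m < L + e / 2" by auto
    define B where "B = Max ((\<lambda>r. \<bar>a r\<bar> + real r * \<bar>a m / real m\<bar>) ` {..<m})"
    have B: "\<bar>a r\<bar> + real r * \<bar>a m / real m\<bar> \<le> B" if "r < m" for r
      unfolding B_def using that by (intro Max_ge) auto
    obtain k0 :: nat where k0: "2 * B / e < real k0" using reals_Archimedean2 by blast
    show "\<exists>k0. \<forall>k\<ge>k0. norm (a k / real k - L) < e"
    proof (intro exI[of _ "Suc k0"] allI impI)
      fix k assume k: "Suc k0 \<le> k"
      then have kpos: "real k > 0" by simp
      define q r where "q = k div m" and "r = k mod m"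
      have r: "r < m" and kqr: "k = q * m + r" using m by (auto simp: q_def r_def)
      have "real q * a m = (real k - real r) * (a m / real m)"
        using m by (simp add: kqr)
      also have "\<dots> = real k * (a m / real m) - real r * (a m / real m)"
        by (rule left_diff_distrib)
      also have "\<dots> \<le> real k * (a m / real m) + real r * \<bar>a m / real m\<bar>"
      proof -
        have "real r * - (a m / real m) \<le> real r * \<bar>a m / real m\<bar>"
          by (intro mult_left_mono abs_ge_minus_self) simp
        then have "- (real r * (a m / real m)) \<le> real r * \<bar>a m / real m\<bar>"
          by (simp only: mult_minus_right)
        then show ?thesis by linarith
      qed
      finally have "a k \<le> real k * (a m / real m) + B"
        using mult[of q m r] B[OF r] unfolding kqr[symmetric] by linarith
      also have "real k * (a m / real m) \<le> real k * (L + e / 2)"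
        using m by (intro mult_left_mono) auto
      also have "B < real k * (e / 2)"
      proof -
        have "2 * B / e < real k" using k0 k by linarith
        then show ?thesis using e by (simp add: field_simps)
      qed
      finally have "a k < real k * (L + e)" by (simp add: algebra_simps)
      then have "a k / real k < L + e" using kpos by (simp add: field_simps)
      moreover have "L \<le> a k / real k"
        unfolding L_def using k by (intro cINF_lower bdd) auto
      ultimately show "norm (a k / real k - L) < e" by simp
    qed
  qed
  then show ?thesis by (auto simp: convergent_def)
qed

lemma fup_norm_eq_opnorm:
  "fup_norm M A k = ell2_opnorm (M ^ k) (restricted_dft (M ^ k) (cantor_set M A k))"
  by (simp add: fup_norm_def)

lemma fup_norm_nonneg: "A \<subseteq> {..<M} \<Longrightarrow> M > 0 \<Longrightarrow> 0 \<le> fup_norm M A k"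
  unfolding fup_norm_eq_opnorm by (intro opnorm_restricted_dft_nonneg cantor_set_less) auto

text \<open>
  The Cooley--Tukey factorisation. Frequencies are written as \<open>x + M ^ k * y\<close> and positions as
  \<open>z + M ^ l * w\<close>, with the long digit block of the one against the short block of the other, so that in
  the product of both modulo \<open>M ^ (k + l)\<close> the term \<open>y * w\<close> disappears. A transform in \<open>w\<close> of order
  \<open>M ^ k\<close>, a unimodular twist in \<open>(x, z)\<close> and a transform in \<open>z\<close> of order \<open>M ^ l\<close> remain.
\<close>

lemma fourier_sum_cantor_set_add:
  assumes A: "A \<subseteq> {..<M}" and M: "M > 0"
  shows "fourier_sum (M ^ (k + l)) (cantor_set M A (k + l)) u (x + M ^ k * y) =
    fourier_sum (M ^ l) (cantor_set M A l)
      (\<lambda>z. wave (M ^ (k + l)) (- (int x * int z)) *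
        fourier_sum (M ^ k) (cantor_set M A k) (\<lambda>w. u (z + M ^ l * w)) x) y"
proof -
  have wave_split: "wave (M ^ (k + l)) (- (int (x + M ^ k * y) * int (z + M ^ l * w))) =
      wave (M ^ l) (- (int y * int z)) *
      (wave (M ^ (k + l)) (- (int x * int z)) * wave (M ^ k) (- (int x * int w)))" for z w
  proof -
    have "- (int (x + M ^ k * y) * int (z + M ^ l * w)) =
      int (M ^ k) * (- (int y * int z)) + (- (int x * int z) + int (M ^ l) * (- (int x * int w)))
      + int (M ^ (k + l)) * (- (int y * int w))"
      by (simp add: algebra_simps power_add)
    moreover have "wave (M ^ (k + l)) (int (M ^ k) * v) = wave (M ^ l) v"
      "wave (M ^ (k + l)) (int (M ^ l) * v) = wave (M ^ k) v" for v
      using wave_mult_cancel[of "M ^ k" "M ^ l" v] wave_mult_cancel[of "M ^ l" "M ^ k" v] M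
      by (simp_all add: power_add mult.commute)
    moreover have "wave (M ^ (k + l)) (int (M ^ (k + l)) * (- (int y * int w))) = 1"
      using M by (subst wave_eq_1_iff) auto
    ultimately show ?thesis by (simp only: wave_add mult_1_right)
  qed
  have sum_eq: "(\<Sum>j\<in>cantor_set M A (k + l). g j) =
      (\<Sum>z\<in>cantor_set M A l. \<Sum>w\<in>cantor_set M A k. g (z + M ^ l * w))" for g :: "nat \<Rightarrow> complex"
    using sum_cantor_set_add[OF A, of g l k] unfolding add.commute[of l k] .
  have "fourier_sum (M ^ (k + l)) (cantor_set M A (k + l)) u (x + M ^ k * y) =
      (\<Sum>z\<in>cantor_set M A l. \<Sum>w\<in>cantor_set M A k.
        wave (M ^ (k + l)) (- (int (x + M ^ k * y) * int (z + M ^ l * w))) * u (z + M ^ l * w))"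
    unfolding fourier_sum_def sum_eq ..
  then show ?thesis
    by (simp only: wave_split) (simp add: fourier_sum_def sum_distrib_left mult.assoc)
qed

lemma fup_norm_add_le:
  assumes A: "A \<subseteq> {..<M}" and M: "M > 0"
  shows "fup_norm M A (k + l) \<le> fup_norm M A k * fup_norm M A l"
  unfolding fup_norm_eq_opnorm[of _ _ "k + l"]
proof (rule opnorm_restricted_dft_le)
  let ?C = "cantor_set M A" and ?r = "fup_norm M A"
  show "?C (k + l) \<subseteq> {..<M ^ (k + l)}" by (rule cantor_set_less[OF A])
  show "M ^ (k + l) > 0" using M by simp
  show "0 \<le> ?r k * ?r l" by (intro mult_nonneg_nonneg fup_norm_nonneg A M)
  have bound: "(\<Sum>j\<in>?C k. cmod (fourier_sum (M ^ k) (?C k) u j) ^ 2)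
      \<le> M ^ k * ?r k ^ 2 * (\<Sum>j\<in>?C k. cmod (u j) ^ 2)" for k u
    unfolding fup_norm_eq_opnorm using M by (intro fourier_sum_le_opnorm cantor_set_less A) simp
  fix u
  define f where "f z = fourier_sum (M ^ k) (?C k) (\<lambda>w. u (z + M ^ l * w))" for z
  have "(\<Sum>j\<in>?C (k + l). cmod (fourier_sum (M ^ (k + l)) (?C (k + l)) u j) ^ 2) =
      (\<Sum>x\<in>?C k. \<Sum>y\<in>?C l. cmod (fourier_sum (M ^ l) (?C l)
        (\<lambda>z. wave (M ^ (k + l)) (- (int x * int z)) * f z x) y) ^ 2)"
    unfolding sum_cantor_set_add[OF A] fourier_sum_cantor_set_add[OF A M] f_def ..
  also have "\<dots> \<le> (\<Sum>x\<in>?C k. M ^ l * ?r l ^ 2 *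
      (\<Sum>z\<in>?C l. cmod (wave (M ^ (k + l)) (- (int x * int z)) * f z x) ^ 2))"
    by (intro sum_mono bound)
  also have "\<dots> = M ^ l * ?r l ^ 2 * (\<Sum>z\<in>?C l. \<Sum>x\<in>?C k. cmod (f z x) ^ 2)"
    by (subst sum.swap) (simp add: norm_mult sum_distrib_left)
  also have "\<dots> \<le> M ^ l * ?r l ^ 2 *
      (\<Sum>z\<in>?C l. M ^ k * ?r k ^ 2 * (\<Sum>w\<in>?C k. cmod (u (z + M ^ l * w)) ^ 2))"
    unfolding f_def by (intro mult_left_mono sum_mono bound) auto
  also have "\<dots> = M ^ (k + l) * (?r k * ?r l) ^ 2 *
      (\<Sum>z\<in>?C l. \<Sum>w\<in>?C k. cmod (u (z + M ^ l * w)) ^ 2)"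
    by (simp add: power_add power_mult_distrib sum_distrib_left[symmetric] mult_ac)
  also have "(\<Sum>z\<in>?C l. \<Sum>w\<in>?C k. cmod (u (z + M ^ l * w)) ^ 2) = (\<Sum>j\<in>?C (k + l). cmod (u j) ^ 2)"
    using sum_cantor_set_add[OF A, of "\<lambda>j. cmod (u j) ^ 2" l k] by (simp add: add.commute)
  finally show "(\<Sum>j\<in>?C (k + l). cmod (fourier_sum (M ^ (k + l)) (?C (k + l)) u j) ^ 2)
      \<le> real (M ^ (k + l)) * (?r k * ?r l) ^ 2 * (\<Sum>j\<in>?C (k + l). cmod (u j) ^ 2)"
    by simp
qed

text \<open>
  Testing with a point mass. The exponential lower bound for \<open>fup_norm\<close> is what keeps the limit in
  the exponent finite.
\<close>

lemma fup_norm_lower: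
  assumes A: "A \<subseteq> {..<M}" "A \<noteq> {}"
  shows "1 \<le> real M ^ k * fup_norm M A k ^ 2"
proof -
  let ?C = "cantor_set M A k"
  have M: "M > 0" using A by (cases M) auto
  obtain a where "a \<in> A" using A by blast
  then have "(\<Sum>j<k. a * M ^ j) \<in> ?C" by (auto simp: cantor_set_def intro!: exI[of _ "\<lambda>_. a"])
  then obtain p where p: "p \<in> ?C" by blast
  have fin: "finite ?C" by (rule finite_cantor_set[OF A(1)])
  define u :: "nat \<Rightarrow> complex" where "u l = of_bool (l = p)" for l
  have "fourier_sum (M ^ k) ?C u j = (\<Sum>l\<in>{p}. wave (M ^ k) (- (int j * int l)) * u l)" for j
    unfolding fourier_sum_def using fin p by (intro sum.mono_neutral_right) (auto simp: u_def)
  then have "cmod (fourier_sum (M ^ k) ?C u p) = 1" by (simp add: u_def)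
  then have "1 \<le> (\<Sum>j\<in>?C. cmod (fourier_sum (M ^ k) ?C u j) ^ 2)"
    using member_le_sum[OF p, of "\<lambda>j. cmod (fourier_sum (M ^ k) ?C u j) ^ 2"] fin by simp
  also have "\<dots> \<le> real (M ^ k) * fup_norm M A k ^ 2 * (\<Sum>l\<in>?C. cmod (u l) ^ 2)"
    unfolding fup_norm_eq_opnorm using M by (intro fourier_sum_le_opnorm cantor_set_less A) simp
  also have "(\<Sum>l\<in>?C. cmod (u l) ^ 2) = (\<Sum>l\<in>{p}. cmod (u l) ^ 2)"
    using fin p by (intro sum.mono_neutral_right) (auto simp: u_def)
  finally show ?thesis by (simp add: u_def)
qed

lemma fup_norm_pos:
  assumes "A \<subseteq> {..<M}" "A \<noteq> {}"
  shows "0 < fup_norm M A k"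
proof -
  have "M > 0" using assms by (cases M) auto
  then show ?thesis
    using fup_norm_nonneg[OF assms(1), of k] fup_norm_lower[OF assms, of k]
    by (cases "fup_norm M A k = 0") auto
qed

lemma fup_exponent_convergent:
  assumes A: "A \<subseteq> {..<M}" "A \<noteq> {}"
  shows "convergent (\<lambda>k. ln (fup_norm M A k) / (real k * ln (real M)))"
proof -
  have M: "M > 0" using A by (cases M) auto
  have "convergent (\<lambda>k. ln (fup_norm M A k) / real k)"
  proof (rule subadditive_imp_convergent)
    fix k l
    have "ln (fup_norm M A (k + l)) \<le> ln (fup_norm M A k * fup_norm M A l)"
      using fup_norm_add_le[OF A(1) M] fup_norm_pos[OF A] by (subst ln_le_cancel_iff) auto
    then show "ln (fup_norm M A (k + l)) \<le> ln (fup_norm M A k) + ln (fup_norm M A l)"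
      using fup_norm_pos[OF A] by (simp add: ln_mult_pos)
  next
    fix k
    have "ln 1 \<le> ln (real M ^ k * fup_norm M A k ^ 2)"
      using fup_norm_lower[OF A, of k] fup_norm_pos[OF A, of k] M by (subst ln_le_cancel_iff) auto
    also have "\<dots> = real k * ln (real M) + 2 * ln (fup_norm M A k)"
      using fup_norm_pos[OF A, of k] M by (simp add: ln_mult_pos ln_realpow)
    finally show "- ln (real M) / 2 * real k \<le> ln (fup_norm M A k)" by (simp add: field_simps)
  qed
  then obtain L where "(\<lambda>k. ln (fup_norm M A k) / real k) \<longlonglongrightarrow> L"
    by (auto simp: convergent_def)
  then have "(\<lambda>k. ln (fup_norm M A k) / real k * (1 / ln (real M))) \<longlonglongrightarrow> L * (1 / ln (real M))"
    by (intro tendsto_mult tendsto_const)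
  then show ?thesis by (auto simp: convergent_def)
qed

lemma fup_norm_energy_bound:
  assumes A: "A \<subseteq> {..<M}" "2 \<le> card A" "4 * card A < 3 * M"
  shows "4 * ln (fup_norm M A k) \<le>
    ln 2 + real k * (ln (511 / 512) + 3 * ln (real (card A)) - 3 / 2 * ln (real M))"
proof -
  let ?n = "real (card A)" and ?r = "fup_norm M A k"
  have ne: "A \<noteq> {}" and M: "M > 0" using A by auto
  have r: "0 < ?r" by (rule fup_norm_pos[OF A(1) ne])
  have n: "?n > 0" using A by simp
  have N: "0 < real (M ^ k)" using M by simp
  have "?r ^ 4 \<le> energy (int (M ^ k)) (cantor_set M A k) 0 / (real (M ^ k) * sqrt (real (M ^ k)))"
    unfolding fup_norm_eq_opnorm using M
    by (intro opnorm_restricted_dft_le_energy cantor_set_less A) simp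
  also have "\<dots> \<le> 2 * (511 / 512 * ?n ^ 3) ^ k / (real (M ^ k) * sqrt (real (M ^ k)))"
    using energy_cantor_le[OF A, of k] N by (intro divide_right_mono) auto
  finally have "ln (?r ^ 4) \<le> ln (2 * (511 / 512 * ?n ^ 3) ^ k / (real (M ^ k) * sqrt (real (M ^ k))))"
    using r n N by (subst ln_le_cancel_iff) auto
  also have "\<dots> = ln 2 + real k * (ln (511 / 512) + 3 * ln ?n) - (ln (real M ^ k) + ln (real M ^ k) / 2)"
    using n N M by (simp add: ln_div ln_mult_pos ln_realpow ln_sqrt)
  also have "ln (real M ^ k) = real k * ln (real M)" using M by (simp add: ln_realpow)
  finally show ?thesis using r by (simp add: ln_realpow algebra_simps)
qed

text \<open>
  The first two terms are what the trivial bound for the energy gives; they cancel at dimension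
  \<open>1 / 2\<close>. The last term is the gain from the carries.
\<close>

lemma fup_exponent_lower:
  assumes A: "A \<subseteq> {..<M}" "2 \<le> card A" "4 * card A < 3 * M"
  shows "fup_exponent M A \<ge> 3 / 8 - 3 / 4 * cantor_dim M A - ln (511 / 512) / (4 * ln (real M))"
proof -
  have ne: "A \<noteq> {}" using A by auto
  have "M > 1" using A by linarith
  then have lnM: "ln (real M) > 0" by simp
  define c where "c = ln (511 / 512) + 3 * ln (real (card A)) - 3 / 2 * ln (real M)"
  let ?f = "\<lambda>k. ln (fup_norm M A k) / (real k * ln (real M))"
  have lim: "?f \<longlonglongrightarrow> lim ?f"
    using fup_exponent_convergent[OF A(1) ne] by (simp add: convergent_LIMSEQ_iff)
  have "(\<lambda>k. ln 2 / (4 * ln (real M)) * (1 / real k) + c / (4 * ln (real M)))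
      \<longlonglongrightarrow> ln 2 / (4 * ln (real M)) * 0 + c / (4 * ln (real M))"
    by (intro tendsto_intros lim_1_over_n)
  then have "lim ?f \<le> ln 2 / (4 * ln (real M)) * 0 + c / (4 * ln (real M))"
  proof (rule LIMSEQ_le[OF lim])
    show "\<exists>n0. \<forall>k\<ge>n0. ?f k \<le> ln 2 / (4 * ln (real M)) * (1 / real k) + c / (4 * ln (real M))"
    proof (intro exI[of _ 1] allI impI)
      fix k :: nat assume k: "1 \<le> k"
      have "4 * ln (fup_norm M A k) \<le> ln 2 + real k * c"
        unfolding c_def by (rule fup_norm_energy_bound[OF A])
      then have "ln (fup_norm M A k) / (real k * ln (real M)) \<le> (ln 2 + real k * c) / 4 / (real k * ln (real M))"
        using k lnM by (intro divide_right_mono) auto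
      also have "\<dots> = ln 2 / (4 * ln (real M)) * (1 / real k) + c / (4 * ln (real M))"
        using k lnM by (simp add: field_simps)
      finally show "?f k \<le> ln 2 / (4 * ln (real M)) * (1 / real k) + c / (4 * ln (real M))" .
    qed
  qed
  moreover have "c / (4 * ln (real M)) =
      ln (511 / 512) / (4 * ln (real M)) + 3 / 4 * cantor_dim M A - 3 / 8"
    using lnM by (simp add: c_def cantor_dim_def field_simps)
  ultimately show ?thesis by (simp add: fup_exponent_def)
qed

theorem proposition3p12:
  "\<exists>K::real. K > 0 \<and>
     (\<forall>(M::nat) (A::nat set).
        A \<subseteq> {..<M} \<and> 1 < card A \<and> card A < M \<and>
        \<bar>cantor_dim M A - 1/2\<bar> \<le> 1 / (K * ln (real M)) \<longrightarrow>
        fup_exponent M A \<ge> max 0 (1/2 - cantor_dim M A) + 1 / (K * ln (real M)))"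
proof (intro exI[of _ 8192] conjI allI impI)
  (* With t = 1 / (K ln M), the claim needs 2 t beyond the possible loss of 3/4 t, while the gain is
     at least (1/512) / (4 ln M) = 4 t for K = 8192. *)
  fix M :: nat and A :: "nat set"
  assume asm: "A \<subseteq> {..<M} \<and> 1 < card A \<and> card A < M \<and>
    \<bar>cantor_dim M A - 1/2\<bar> \<le> 1 / (8192 * ln (real M))"
  let ?n = "real (card A)" and ?\<delta> = "cantor_dim M A"
  define t where "t = 1 / (8192 * ln (real M))"
  have M: "M \<ge> 3" using asm by linarith
  then have lnM: "ln (real M) > 0" by simp
  have \<delta>: "\<bar>?\<delta> - 1/2\<bar> \<le> t" using asm by (simp add: t_def)
  have n: "?n > 0" using asm by simp
  (* card A is at most exp (1/K) * sqrt M, and M is at least 3. *)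
  have "4 * card A < 3 * M"
  proof -
    have "ln (?n ^ 2) = 2 * ?\<delta> * ln (real M)"
      using n lnM by (simp add: cantor_dim_def ln_realpow)
    also have "\<dots> \<le> 2 * (1 / 2 + t) * ln (real M)"
      using \<delta> lnM by (intro mult_right_mono) (auto simp: abs_le_iff)
    also have "\<dots> = ln (real M) + 1 / 4096"
      using lnM by (simp add: t_def field_simps)
    also have "\<dots> \<le> ln (real M) + ln (3 / 2)"
      using ln_le_minus_one[of "2 / 3 :: real"] by (simp add: ln_div)
    also have "ln (real M) + ln (3 / 2) = ln (real M * (3 / 2))"
      using M by (subst ln_mult_pos) auto
    finally have "?n ^ 2 \<le> real M * (3 / 2)"
      using n M by (subst (asm) ln_le_cancel_iff) auto
    also have "\<dots> \<le> real M * (1 / 2 * real M)" using M by (intro mult_left_mono) auto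
    also have "\<dots> < (3 / 4 * real M) ^ 2" using M by (simp add: power2_eq_square)
    finally have "?n < 3 / 4 * real M" by (rule power2_less_imp_less) simp
    then show ?thesis by linarith
  qed
  then have "3 / 8 - 3 / 4 * ?\<delta> - ln (511 / 512) / (4 * ln (real M)) \<le> fup_exponent M A"
    using asm by (intro fup_exponent_lower) auto
  moreover have "4 * t \<le> - ln (511 / 512) / (4 * ln (real M))"
  proof -
    have "1 / 512 \<le> - ln (511 / 512 :: real)"
      using ln_le_minus_one[of "511 / 512 :: real"] by simp
    then show ?thesis using lnM by (simp add: t_def field_simps)
  qed
  moreover have "3 / 8 - 3 / 4 * ?\<delta> \<ge> - (3 / 4 * t)" "max 0 (1/2 - ?\<delta>) \<le> t"
    using \<delta> lnM by (auto simp: t_def abs_le_iff)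
  moreover have "t > 0" using lnM by (simp add: t_def)
  ultimately show "max 0 (1/2 - ?\<delta>) + 1 / (8192 * ln (real M)) \<le> fup_exponent M A"
    unfolding t_def[symmetric] by linarith
qed simp

end
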